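(* Let $n\ge 2$ be an integer. The differential of $S_n(A)$ with respect to the variables $J_\Delta,N_\Delta$ ($\Delta\subset\mathcal S$) is $$\delta S_n(A)=\sum_{\Delta\subset\mathcal S}\Big[\lambda_\Delta(n)\,\delta J_\Delta+\sigma_\Delta(n)\,\delta N_\Delta\Big],\qquad \lambda_\Delta(n)=\frac{\beta^{(n)}_\Delta-n\beta_\Delta}{1-n},\quad \sigma_\Delta(n)=\frac{\mu^{(n)}_\Delta-n\mu_\Delta}{1-n}.$$ When all $\Delta\subset\mathcal S$ have the same $n_v(\Delta)$, the quantities $\beta^{(n)}_\Delta,\beta_\Delta,\mu^{(n)}_\Delta,\mu_\Delta$ become independent of $\Delta$; in this case $\lambda_\Delta(n)\equiv\lambda(n)$ and $\sigma_\Delta(n)\equiv\sigma(n)$ are independent of $\Delta$, and $\delta S_n(A)$ reduces to $$\delta S_n(A)=\lambda(n)\,\delta J_{\mathcal S}+\sigma(n)\,\delta N_{\mathcal S},\qquad J_{\mathcal S}=\sum_{\Delta\subset\mathcal S}J_\Delta,\quad N_{\mathcal S}=\sum_{\Delta\subset\mathcal S}N_\Delta .$$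
   Context: $\mathcal S$ is a surface triangulated by a finite set of triangles $\Delta$. To each $\Delta\subset\mathcal S$ are attached a positive integer $n_v(\Delta)$ (the number of 4-cells sharing $\Delta$) and two positive variables $J_\Delta$ (total spin, i.e. area) and $N_\Delta$ (number of facets), treated as continuous real variables with $J_\Delta>N_\Delta/2$. For an integer $n\ge1$ and $j\in\{\frac12,1,\frac32,\dots\}$ put $$g^{(n)}_\Delta(j)=(2j+1)^{2n(n_v(\Delta)+1)+1},$$ and write $g_\Delta=g^{(1)}_\Delta$, so that $g_\Delta(j)=(2j+1)^{2n_v(\Delta)+3}$. All sums over $j$ run over $j=\frac12,1,\frac32,\dots$. Let $z_0^{(n)}\in(0,1)$ be the solution of $$\frac{\sum_{j} j\,[z_0^{(n)}]^{2j}g^{(n)}_\Delta(j)}{\sum_{j}[z_0^{(n)}]^{2j}g^{(n)}_\Delta(j)}=\frac{J_\Delta}{N_\Delta},$$ and define $\beta^{(n)}_\Delta,\mu^{(n)}_\Delta$, as functions of $(J_\Delta,N_\Delta)$, by $$e^{-\beta^{(n)}_\Delta/2}=z_0^{(n)},\qquad e^{\mu^{(n)}_\Delta}=\sum_{j}e^{-\beta^{(n)}_\Delta j}g^{(n)}_\Delta(j).$$ Write $\beta_\Delta=\beta^{(1)}_\Delta$ and $\mu_\Delta=\mu^{(1)}_\Delta$. For $n\ge2$, the (leading-order) $n$-th Rényi entanglement entropy is the function of the variables $(J_\Delta,N_\Delta)_{\Delta\subset\mathcal S}$ $$S_n(A)=\sum_{\Delta\subset\mathcal S}\left[\frac{\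beta^{(n)}_\Delta-n\beta_\Delta}{1-n}\,J_\Delta+\frac{\mu^{(n)}_\Delta-n\mu_\Delta}{1-n}\,N_\Delta\right].$$
   Formalization: The second half is false with equal n_v alone, since β^{(n)}_Δ determines J_Δ/N_Δ; independence of values from Δ and the reduced form of δS_n are stated where J_Δ/N_Δ is also common to all Δ, and with equal n_v alone only that they are the same functions of (J_Δ,N_Δ). *)

theory Defs
  imports "HOL-Analysis.Analysis"
begin

definition spins :: "real set" where
  "spins = {j. \<exists>k::nat. 1 \<le> k \<and> j = real k / 2}"

text \<open>Throughout, \<open>n\<close> is the Renyi index, \<open>v\<close> is the value \<open>n\<^sub>v(\<Delta>)\<close> attached to a
  triangle, and \<open>x\<close>, \<open>y\<close> stand for \<open>J\<^sub>\<Delta>\<close>, \<open>N\<^sub>\<Delta>\<close>.\<close>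

definition degen :: "nat \<Rightarrow> nat \<Rightarrow> real \<Rightarrow> real" where
  "degen n v j = (2 * j + 1) ^ (2 * n * (v + 1) + 1)"

text \<open>The exponent \<open>2 * j\<close> is a positive integer written as a real number; on \<open>0 < z < 1\<close> the
  real power \<open>z powr (2 * j)\<close> is the ordinary one. The solution exists and is unique when
  \<open>0 < y\<close> and \<open>y / 2 < x\<close>; outside this domain the value is irrelevant.\<close>

definition z0 :: "nat \<Rightarrow> nat \<Rightarrow> real \<Rightarrow> real \<Rightarrow> real" where
  "z0 n v x y = (THE z. 0 < z \<and> z < 1 \<and>
     (\<Sum>\<^sub>\<infinity>j\<in>spins. j * z powr (2 * j) * degen n v j) /
     (\<Sum>\<^sub>\<infinity>j\<in>spins. z powr (2 * j) * degen n v j) = x / y)"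

text \<open>The next two are the relations \<open>exp (- \<beta> / 2) = z0\<close> and
  \<open>exp \<mu> = (\<Sum>j. exp (- \<beta> * j) * degen j)\<close>, solved for \<open>\<beta>\<close> and \<open>\<mu>\<close>.\<close>

definition beta :: "nat \<Rightarrow> nat \<Rightarrow> real \<Rightarrow> real \<Rightarrow> real" where
  "beta n v x y = - 2 * ln (z0 n v x y)"

definition mu :: "nat \<Rightarrow> nat \<Rightarrow> real \<Rightarrow> real \<Rightarrow> real" where
  "mu n v x y = ln (\<Sum>\<^sub>\<infinity>j\<in>spins. exp (- beta n v x y * j) * degen n v j)"

definition renyi_lambda :: "nat \<Rightarrow> nat \<Rightarrow> real \<Rightarrow> real \<Rightarrow> real" where
  "renyi_lambda n v x y = (beta n v x y - real n * beta 1 v x y) / (1 - real n)"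

definition renyi_sigma :: "nat \<Rightarrow> nat \<Rightarrow> real \<Rightarrow> real \<Rightarrow> real" where
  "renyi_sigma n v x y = (mu n v x y - real n * mu 1 v x y) / (1 - real n)"

text \<open>The finite type \<open>'t\<close> is the set of triangles of the surface; a point
  \<open>(J, N)\<close> collects the variables \<open>J\<^sub>\<Delta> = J $ \<Delta>\<close> and \<open>N\<^sub>\<Delta> = N $ \<Delta>\<close>.\<close>

definition renyi_entropy :: "('t::finite \<Rightarrow> nat) \<Rightarrow> nat \<Rightarrow> (real^'t) \<times> (real^'t) \<Rightarrow> real" where
  "renyi_entropy nv n = (\<lambda>(J, N). \<Sum>\<Delta>\<in>UNIV.
      (beta n (nv \<Delta>) (J $ \<Delta>) (N $ \<Delta>) - real n * beta 1 (nv \<Delta>) (J $ \<Delta>) (N $ \<Delta>)) / (1 - real n) * J $ \<Delta>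
    + (mu n (nv \<Delta>) (J $ \<Delta>) (N $ \<Delta>) - real n * mu 1 (nv \<Delta>) (J $ \<Delta>) (N $ \<Delta>)) / (1 - real n) * N $ \<Delta>)"

text \<open>\<open>J\<^sub>S\<close> and \<open>N\<^sub>S\<close> are \<open>total_over J\<close> and \<open>total_over N\<close>. Since \<open>total_over\<close> is linear, their
  differentials in the direction \<open>(dJ, dN)\<close> are \<open>total_over dJ\<close> and \<open>total_over dN\<close>.\<close>

definition total_over :: "real^'t::finite \<Rightarrow> real" where
  "total_over x = (\<Sum>\<Delta>\<in>UNIV. x $ \<Delta>)"

end

theory Submission
  imports Defs
begin

text \<open>For one triangle, let \<open>F z\<close> be the sum of \<open>z ^ (2 * j) * degen n v j\<close> over the spins and
  \<open>r = J / N\<close>. The mean spin \<open>z * F' z / (2 * F z)\<close> has derivative a positive multiple of a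
  variance, so it increases strictly, from \<open>1 / 2\<close> at \<open>z = 0\<close> to infinity at \<open>z = 1\<close>, and
  \<open>z0\<close> is a differentiable function of \<open>r\<close>. The contribution \<open>\<beta> * J + \<mu> * N\<close> equals \<open>N * \<psi> r\<close>
  with \<open>\<psi> r = - 2 * r * ln z0 + ln (F z0)\<close>, a Legendre transform with \<open>\<psi>' = \<beta>\<close>; hence its
  differential is \<open>\<beta> dJ + \<mu> dN\<close>.\<close>

section \<open>Moments of the spin distribution as power series\<close>

text \<open>Power series are indexed by \<open>k = 2 * j\<close>; there is no spin \<open>j = 0\<close>.\<close>

definition spin_coeff :: "nat \<Rightarrow> nat \<Rightarrow> real" where
  "spin_coeff M k = (if k = 0 then 0 else (real k + 1) ^ M)"

text \<open>Unnormalised moments of \<open>k = 2 * j\<close>. Raising \<open>p\<close> by one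
  amounts to applying \<open>z * d/dz\<close>; \<open>p = 0\<close> gives the function
  \<open>F\<close> of the outline. The exponent \<open>M\<close> is later set to
  \<open>2 * n * (v + 1) + 1\<close>.\<close>

definition spin_moment :: "nat \<Rightarrow> nat \<Rightarrow> real \<Rightarrow> real" where
  "spin_moment M p z = (\<Sum>k. real k ^ p * spin_coeff M k * z ^ k)"

lemma spin_coeff_0 [simp]: "spin_coeff M 0 = 0"
  by (simp add: spin_coeff_def)

lemma spin_coeff_nonneg [simp]: "0 \<le> spin_coeff M k"
  by (simp add: spin_coeff_def)

lemma spin_coeff_ge_1: "1 \<le> k \<Longrightarrow> 1 \<le> spin_coeff M k"
  by (simp add: spin_coeff_def)

text \<open>Termwise differentiation preserves convergence for |z| < 1; multiplying by
  \<open>z\<close> afterwards restores the powers of \<open>z\<close> and leaves one more factor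
  \<open>k\<close>.\<close>

lemma summable_power_times_power:
  fixes z :: real
  assumes "\<bar>z\<bar> < 1"
  shows "summable (\<lambda>k. real k ^ m * z ^ k)"
  using assms
proof (induction m arbitrary: z)
  case 0
  then show ?case by (simp add: summable_geometric)
next
  case (Suc m)
  have "summable (\<lambda>k. diffs (\<lambda>k. real k ^ m) k * z ^ k)"
    by (rule termdiff_converges[of z 1]) (use Suc in auto)
  then have "summable (\<lambda>k. z * (diffs (\<lambda>k. real k ^ m) k * z ^ k))"
    by (rule summable_mult)
  then have "summable (\<lambda>k. real (Suc k) ^ Suc m * z ^ Suc k)"
    by (simp add: diffs_def mult_ac)
  then show ?case by (subst summable_Suc_iff[symmetric])
qed

lemma summable_spin_moment:
  fixes z :: real
  assumes "\<bar>z\<bar> < 1"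
  shows "summable (\<lambda>k. real k ^ p * spin_coeff M k * z ^ k)"
proof (rule summable_comparison_test')
  show "summable (\<lambda>k. 2 ^ M * (real k ^ (p + M) * \<bar>z\<bar> ^ k))"
    using assms by (intro summable_mult summable_power_times_power) auto
next
  fix k :: nat
  \<comment> \<open>For positive \<open>k\<close> this is \<open>k + 1\<close> \<le>
    \<open>2 * k\<close>; at \<open>k = 0\<close> the left side is 0.\<close>
  have "spin_coeff M k \<le> (2 * real k) ^ M"
    using power_mono[of "real k + 1" "2 * real k" M] by (cases k) (auto simp: spin_coeff_def)
  then have "spin_coeff M k \<le> 2 ^ M * real k ^ M"
    by (simp only: power_mult_distrib)
  then have "real k ^ p * spin_coeff M k * \<bar>z\<bar> ^ k \<le> real k ^ p * (2 ^ M * real k ^ M) * \<bar>z\<bar> ^ k"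
    by (intro mult_left_mono mult_right_mono) auto
  then show "norm (real k ^ p * spin_coeff M k * z ^ k) \<le> 2 ^ M * (real k ^ (p + M) * \<bar>z\<bar> ^ k)"
    by (simp add: abs_mult power_abs power_add mult_ac)
qed

lemma spin_moment_pos:
  assumes "0 < z" "z < 1"
  shows "0 < spin_moment M p z"
  unfolding spin_moment_def
proof (rule suminf_pos2[where i = 1])
  show "0 < real 1 ^ p * spin_coeff M 1 * z ^ 1"
    using assms by (simp add: spin_coeff_def)
qed (use assms summable_spin_moment[of z] in auto)

lemma DERIV_spin_moment:
  assumes "0 < z" "z < 1"
  shows "(spin_moment M p has_real_derivative spin_moment M (Suc p) z / z) (at z)"
proof -
  let ?c = "\<lambda>k. real k ^ p * spin_coeff M k"
  have D: "(spin_moment M p has_real_derivative (\<Sum>k. diffs ?c k * z ^ k)) (at z)"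
    unfolding spin_moment_def
  proof (rule termdiffs_strong')
    show "summable (\<lambda>k. ?c k * x ^ k)" if "norm x < 1" for x
      using summable_spin_moment that by simp
  qed (use assms in auto)
  have "(\<Sum>k. diffs ?c k * z ^ k) = (\<Sum>k. (real (Suc k) ^ Suc p * spin_coeff M (Suc k) * z ^ Suc k) / z)"
    using assms by (simp add: diffs_def mult_ac)
  also have "\<dots> = (\<Sum>k. real (Suc k) ^ Suc p * spin_coeff M (Suc k) * z ^ Suc k) / z"
    using summable_spin_moment[of z "Suc p" M] assms
    by (intro suminf_divide) (subst summable_Suc_iff, auto)
  \<comment> \<open>The term with index 0 vanishes, so the shifted series is the full
    moment.\<close>
  also have "\<dots> = spin_moment M (Suc p) z / z"
    unfolding spin_moment_def
    by (subst suminf_split_head) (use summable_spin_moment[of z "Suc p" M] assms in auto)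
  finally show ?thesis using D by simp
qed

section \<open>The mean spin and its strict monotonicity\<close>

definition mean_spin :: "nat \<Rightarrow> real \<Rightarrow> real" where
  "mean_spin M z = spin_moment M 1 z / 2 / spin_moment M 0 z"

text \<open>With \<open>a\<close> the mean of \<open>k\<close>, the difference is
  \<open>spin_moment M 0 z\<close> times the weighted sum of the squares of
  \<open>k - a\<close>.\<close>

lemma spin_moment_variance_pos:
  assumes "0 < z" "z < 1"
  shows "0 < spin_moment M 2 z * spin_moment M 0 z - (spin_moment M 1 z)\<^sup>2"
proof -
  define a where "a = spin_moment M 1 z / spin_moment M 0 z"
  note s = summable_spin_moment[of z _ M]
  have F: "0 < spin_moment M 0 z" by (rule spin_moment_pos[OF assms])
  have *: "(\<lambda>k. (real k ^ 2 * spin_coeff M k * z ^ k - 2 * a * (real k ^ 1 * spin_coeff M k * z ^ k))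
            + a\<^sup>2 * (real k ^ 0 * spin_coeff M k * z ^ k)) sums
         ((spin_moment M 2 z - 2 * a * spin_moment M 1 z) + a\<^sup>2 * spin_moment M 0 z)"
    unfolding spin_moment_def
    by (intro sums_add sums_diff sums_mult summable_sums s) (use assms in auto)
  moreover have "(\<lambda>k. (real k ^ 2 * spin_coeff M k * z ^ k - 2 * a * (real k ^ 1 * spin_coeff M k * z ^ k))
            + a\<^sup>2 * (real k ^ 0 * spin_coeff M k * z ^ k)) = (\<lambda>k. (real k - a)\<^sup>2 * spin_coeff M k * z ^ k)"
    by (simp add: fun_eq_iff algebra_simps power2_eq_square)
  ultimately have sums: "(\<lambda>k. (real k - a)\<^sup>2 * spin_coeff M k * z ^ k) sums
         (spin_moment M 2 z - 2 * a * spin_moment M 1 z + a\<^sup>2 * spin_moment M 0 z)"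
    by simp
  \<comment> \<open>Strictness: the indices 1 and 2 both carry positive weight, and at least one of
    them differs from the mean \<open>a\<close>.\<close>
  obtain i :: nat where i: "0 < i" "real i \<noteq> a"
  proof (cases "a = 1")
    case True
    then show ?thesis by (intro that[of 2]) auto
  next
    case False
    then show ?thesis by (intro that[of 1]) auto
  qed
  have "0 < (\<Sum>k. (real k - a)\<^sup>2 * spin_coeff M k * z ^ k)"
    by (rule suminf_pos2[where i = i])
      (use i assms sums in \<open>auto simp: sums_iff spin_coeff_def\<close>)
  then have "0 < spin_moment M 2 z - 2 * a * spin_moment M 1 z + a\<^sup>2 * spin_moment M 0 z"
    using sums by (simp add: sums_iff)
  then have "0 < (spin_moment M 2 z - 2 * a * spin_moment M 1 z + a\<^sup>2 * spin_moment M 0 z) * spin_moment M 0 z"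
    using F by simp
  also have "\<dots> = spin_moment M 2 z * spin_moment M 0 z - (spin_moment M 1 z)\<^sup>2"
    using F by (simp add: a_def field_simps power2_eq_square)
  finally show ?thesis .
qed

lemma DERIV_mean_spin:
  assumes "0 < z" "z < 1"
  shows "\<exists>D. (mean_spin M has_real_derivative D) (at z) \<and> 0 < D"
proof -
  have F: "0 < spin_moment M 0 z" by (rule spin_moment_pos[OF assms])
  \<comment> \<open>Quotient rule: each differentiation raises the order of a moment by one and
    divides by \<open>z\<close>, so the numerator is the variance expression.\<close>
  let ?D = "(spin_moment M 2 z * spin_moment M 0 z - (spin_moment M 1 z)\<^sup>2) / (2 * z * (spin_moment M 0 z)\<^sup>2)"
  have "(mean_spin M has_real_derivative ?D) (at z)"
    unfolding mean_spin_def
    using F assms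
    by (auto intro!: derivative_eq_intros DERIV_spin_moment
        simp: field_simps power2_eq_square numeral_2_eq_2)
  moreover have "0 < ?D"
    using spin_moment_variance_pos[OF assms] F assms by simp
  ultimately show ?thesis by blast
qed

lemma mean_spin_less:
  assumes "0 < z" "z < w" "w < 1"
  shows "mean_spin M z < mean_spin M w"
  by (rule DERIV_pos_imp_increasing[OF assms(2)])
    (use assms in \<open>auto intro!: DERIV_mean_spin\<close>)

lemma mean_spin_inj: "inj_on (mean_spin M) {0<..<1}"
proof (rule inj_onI)
  fix z w assume "z \<in> {0<..<1}" "w \<in> {0<..<1}" "mean_spin M z = mean_spin M w"
  then show "z = w"
    using mean_spin_less[of z w M] mean_spin_less[of w z M] by (cases z w rule: linorder_cases) auto
qed

section \<open>Continuity and range of the mean spin\<close>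

lemma continuous_on_mean_spin: "continuous_on {0<..<1} (mean_spin M)"
proof (rule continuous_at_imp_continuous_on, rule ballI)
  fix z :: real assume "z \<in> {0<..<1}"
  then show "isCont (mean_spin M) z"
    using DERIV_mean_spin[of z M] by (auto dest: DERIV_isCont)
qed

text \<open>Clears the denominator: for \<open>z\<close> strictly between 0 and 1 the sign of this
  sum is the sign of \<open>mean_spin M z - r\<close>.\<close>

lemma moment_combination_sums:
  assumes "\<bar>z\<bar> < 1"
  shows "(\<lambda>k. (real k - 2 * r) * spin_coeff M k * z ^ k) sums (spin_moment M 1 z - 2 * r * spin_moment M 0 z)"
proof -
  have "(\<lambda>k. real k ^ 1 * spin_coeff M k * z ^ k - 2 * r * (real k ^ 0 * spin_coeff M k * z ^ k)) sums
      (spin_moment M 1 z - 2 * r * spin_moment M 0 z)"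
    unfolding spin_moment_def
    by (intro sums_diff sums_mult summable_sums summable_spin_moment assms)
  then show ?thesis by (simp add: algebra_simps)
qed

text \<open>As \<open>z\<close> tends to 0 the lowest spin, \<open>k = 1\<close>, dominates and the
  mean spin tends to 1/2, which lies below \<open>r\<close>.\<close>

lemma mean_spin_small:
  assumes "1 / 2 < r"
  shows "\<exists>z. 0 < z \<and> z < 1 \<and> mean_spin M z < r"
proof -
  define c where "c k = (real (Suc k) - 2 * r) * spin_coeff M (Suc k)" for k
  txt \<open>Dividing out the factor \<open>z\<close> leaves a series with the negative constant term \<open>c 0\<close>.\<close>
  have sums: "(\<lambda>k. z * (c k * z ^ k)) sums (spin_moment M 1 z - 2 * r * spin_moment M 0 z)"
    if "\<bar>z\<bar> < 1" for z
    using sums_Suc_iff[of "\<lambda>k. (real k - 2 * r) * spin_coeff M k * z ^ k"]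
      moment_combination_sums[OF that, of r M]
    by (simp add: c_def mult_ac)
  have summ: "summable (\<lambda>k. c k * z ^ k)" if "norm z < 1" for z
  proof (cases "z = 0")
    case False
    then show ?thesis
      using sums[of z] that summable_cmult_iff[of z "\<lambda>k. c k * z ^ k"] by (auto simp: sums_iff)
  qed (simp add: powser_sums_zero_iff)
  let ?q = "\<lambda>z. \<Sum>k. c k * z ^ k"
  have "isCont ?q 0"
    by (rule DERIV_isCont[OF termdiffs_strong'[OF summ]]) auto
  \<comment> \<open>The value is \<open>c 0 = (1 - 2 * r) * 2 ^ M\<close>.\<close>
  moreover have "?q 0 < 0"
    using assms by (simp add: powser_zero c_def spin_coeff_def mult_neg_pos)
  ultimately have "\<forall>\<^sub>F z in at 0. ?q z < 0"
    by (auto simp: isCont_def intro: order_tendstoD)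
  then have "\<forall>\<^sub>F z in at_right 0. ?q z < 0"
    by (simp add: eventually_at_split)
  moreover have "\<forall>\<^sub>F z::real in at_right 0. z \<in> {0<..<1}"
    by (rule eventually_at_right_real) simp
  ultimately have "\<forall>\<^sub>F z in at_right 0. ?q z < 0 \<and> z \<in> {0<..<1}"
    by (rule eventually_conj)
  then obtain z where z: "0 < z" "z < 1" "?q z < 0"
    using eventually_happens'[OF trivial_limit_at_right_real] by auto
  then have "z * ?q z < 0" by (simp add: mult_pos_neg)
  also have "z * ?q z = spin_moment M 1 z - 2 * r * spin_moment M 0 z"
    using sums[of z] summ[of z] z by (simp add: sums_iff suminf_mult)
  finally have "mean_spin M z < r"
    using spin_moment_pos[of z M 0] z by (simp add: mean_spin_def field_simps)
  then show ?thesis using z by blast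
qed

lemma mean_spin_large: "\<exists>z. 0 < z \<and> z < 1 \<and> r < mean_spin M z"
proof -
  define p where "p L z = (\<Sum>k<L. (real k - 2 * r) * spin_coeff M k * z ^ k)" for L :: nat and z :: real
  txt \<open>All terms with \<open>k \<ge> K\<close> are nonnegative, and at \<open>z = 1\<close> they are at least 1; so a partial
    sum that is positive at 1, hence just below 1, bounds the whole series from below.\<close>
  obtain K :: nat where K: "max 1 (2 * r + 1) \<le> real K"
    using real_arch_simple by blast
  \<comment> \<open>Each of the \<open>d\<close> terms following index \<open>K\<close> adds at
    least 1 at \<open>z = 1\<close>, so \<open>d\<close> is chosen to outweigh a possible deficit
    \<open>- p K 1\<close>.\<close>
  obtain d :: nat where d: "- p K 1 < real d"
    using reals_Archimedean2 by blast
  have "p (K + d) 1 = p K 1 + (\<Sum>k=K..<K + d. (real k - 2 * r) * spin_coeff M k)"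
    unfolding p_def lessThan_atLeast0 by (subst sum.atLeastLessThan_concat[of 0 K, symmetric]) auto
  moreover have "(\<Sum>k=K..<K + d. (1::real)) \<le> (\<Sum>k=K..<K + d. (real k - 2 * r) * spin_coeff M k)"
  proof (rule sum_mono)
    fix k assume "k \<in> {K..<K + d}"
    then have "1 \<le> real k - 2 * r" "1 \<le> spin_coeff M k"
      using K by (auto intro: spin_coeff_ge_1)
    then show "1 \<le> (real k - 2 * r) * spin_coeff M k"
      using mult_mono[of 1 "real k - 2 * r" 1 "spin_coeff M k"] by simp
  qed
  ultimately have "0 < p (K + d) 1" using d by simp
  moreover have "isCont (p (K + d)) 1"
    unfolding p_def by (intro continuous_intros)
  ultimately have "\<forall>\<^sub>F z in at 1. 0 < p (K + d) z"
    by (auto simp: isCont_def intro: order_tendstoD)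
  then have "\<forall>\<^sub>F z in at_left 1. 0 < p (K + d) z"
    by (simp add: eventually_at_split)
  moreover have "\<forall>\<^sub>F z::real in at_left 1. z \<in> {0<..<1}"
    by (rule eventually_at_left_real) simp
  ultimately have "\<forall>\<^sub>F z in at_left 1. 0 < p (K + d) z \<and> z \<in> {0<..<1}"
    by (rule eventually_conj)
  then obtain z where z: "0 < z" "z < 1" "0 < p (K + d) z"
    using eventually_happens'[OF trivial_limit_at_left_real] by auto
  have sums: "(\<lambda>k. (real k - 2 * r) * spin_coeff M k * z ^ k) sums (spin_moment M 1 z - 2 * r * spin_moment M 0 z)"
    by (rule moment_combination_sums) (use z in auto)
  have "p (K + d) z \<le> (\<Sum>k. (real k - 2 * r) * spin_coeff M k * z ^ k)"
    unfolding p_def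
    by (rule sum_le_suminf) (use sums z K in \<open>auto simp: sums_iff\<close>)
  then have "0 < spin_moment M 1 z - 2 * r * spin_moment M 0 z"
    using sums z by (simp add: sums_iff)
  then have "r < mean_spin M z"
    using spin_moment_pos[of z M 0] z by (simp add: mean_spin_def field_simps)
  then show ?thesis using z by blast
qed

lemma mean_spin_surj:
  assumes "1 / 2 < r"
  shows "\<exists>z. 0 < z \<and> z < 1 \<and> mean_spin M z = r"
proof -
  obtain a where a: "0 < a" "a < 1" "mean_spin M a < r"
    using mean_spin_small[OF assms] by blast
  obtain b where b: "0 < b" "b < 1" "r < mean_spin M b"
    using mean_spin_large by blast
  have "a \<le> b"
    using mean_spin_less[of b a M] a b by (cases "a \<le> b") auto
  moreover have "continuous_on {a..b} (mean_spin M)"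
    by (rule continuous_on_subset[OF continuous_on_mean_spin]) (use a b in auto)
  ultimately obtain z where "a \<le> z" "z \<le> b" "mean_spin M z = r"
    using IVT'[of "mean_spin M" a r b] a b by auto
  then show ?thesis using a b by (intro exI[of _ z]) auto
qed

section \<open>Inverting the mean spin; the Legendre transform\<close>

text \<open>The equation for \<open>z0\<close> involves the two variables only through their
  quotient \<open>r\<close>, so the inversion is a problem in one real variable.\<close>

definition fugacity :: "nat \<Rightarrow> real \<Rightarrow> real" where
  "fugacity M r = (THE z. 0 < z \<and> z < 1 \<and> mean_spin M z = r)"

lemma fugacity_mean_spin:
  assumes "0 < z" "z < 1"
  shows "fugacity M (mean_spin M z) = z"
  unfolding fugacity_def
  by (rule the_equality) (use assms mean_spin_inj[of M] in \<open>auto simp: inj_on_def\<close>)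

lemma fugacity:
  assumes "1 / 2 < r"
  shows "0 < fugacity M r" "fugacity M r < 1" "mean_spin M (fugacity M r) = r"
  using mean_spin_surj[OF assms, of M] fugacity_mean_spin by auto

text \<open>Inverse function theorem: \<open>mean_spin M\<close> is continuous on the open unit
  interval, \<open>fugacity M\<close> is a left inverse there, and the derivative at
  \<open>fugacity M r\<close> is positive, hence invertible.\<close>

lemma fugacity_differentiable:
  assumes "1 / 2 < r"
  shows "\<exists>D. (fugacity M has_real_derivative D) (at r)"
proof -
  note z = fugacity[OF assms, of M]
  obtain D where D: "(mean_spin M has_real_derivative D) (at (fugacity M r))" "0 < D"
    using DERIV_mean_spin[OF z(1,2)] by blast
  have "(fugacity M has_real_derivative inverse D) (at r)"
    unfolding has_field_derivative_def
    by (rule has_derivative_inverse_strong_x[where S = "{0<..<1}" and f = "mean_spin M"])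
      (use D z fugacity_mean_spin continuous_on_mean_spin in
        \<open>auto simp: has_field_derivative_def fun_eq_iff\<close>)
  then show ?thesis by blast
qed

text \<open>The derivative of \<open>fugacity\<close> drops out: \<open>- 2 * r * ln z + ln (spin_moment M 0 z)\<close> is stationary in \<open>z\<close>
  exactly where the mean spin is \<open>r\<close>.\<close>

lemma DERIV_legendre:
  assumes "1 / 2 < r"
  shows "((\<lambda>r. - 2 * r * ln (fugacity M r) + ln (spin_moment M 0 (fugacity M r)))
           has_real_derivative - 2 * ln (fugacity M r)) (at r)"
proof -
  note z = fugacity[OF assms, of M]
  obtain D where D: "(fugacity M has_real_derivative D) (at r)"
    using fugacity_differentiable[OF assms] by blast
  have F: "0 < spin_moment M 0 (fugacity M r)"
    by (rule spin_moment_pos[OF z(1,2)])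
  \<comment> \<open>The stationarity condition: it turns the logarithmic derivative of the zeroth
    moment into \<open>2 * r / z\<close>, which cancels the derivative of
    \<open>- 2 * r * ln z\<close> in \<open>z\<close>.\<close>
  have G: "spin_moment M 1 (fugacity M r) = 2 * r * spin_moment M 0 (fugacity M r)"
    using z(3) F by (simp add: mean_spin_def field_simps)
  have "((\<lambda>r. spin_moment M 0 (fugacity M r)) has_real_derivative
      spin_moment M (Suc 0) (fugacity M r) / fugacity M r * D) (at r)"
    by (rule DERIV_chain2[OF DERIV_spin_moment[OF z(1,2)] D])
  from DERIV_chain2[OF DERIV_ln_divide[OF F] this]
  have "((\<lambda>r. ln (spin_moment M 0 (fugacity M r))) has_real_derivative 2 * r * D / fugacity M r) (at r)"
    using F G by (simp add: field_simps)
  moreover have "((\<lambda>r. ln (fugacity M r)) has_real_derivative D / fugacity M r) (at r)"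
    using DERIV_chain2[OF DERIV_ln_divide[OF z(1)] D] by simp
  ultimately have "((\<lambda>r. - 2 * r * ln (fugacity M r) + ln (spin_moment M 0 (fugacity M r)))
      has_real_derivative (- 2 * r * (D / fugacity M r) + - 2 * ln (fugacity M r)) + 2 * r * D / fugacity M r) (at r)"
    by (intro DERIV_add DERIV_mult' DERIV_cmult_Id)
  then show ?thesis by simp
qed

section \<open>From sums over spins to power series\<close>

text \<open>Substituting \<open>j = k / 2\<close> turns \<open>z powr (2 * j)\<close> into
  \<open>z ^ k\<close> and \<open>2 * j + 1\<close> into \<open>k + 1\<close>; the factor
  \<open>2 ^ p\<close> comes from \<open>j ^ p\<close>.\<close>

lemma infsum_spins:
  assumes "0 < z" "z < 1"
  shows "(\<Sum>\<^sub>\<infinity>j\<in>spins. j ^ p * z powr (2 * j) * degen n v j)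
       = spin_moment (2 * n * (v + 1) + 1) p z / 2 ^ p"
proof -
  let ?M = "2 * n * (v + 1) + 1"
  let ?f = "\<lambda>k. real k ^ p * spin_coeff ?M k * z ^ k"
  have s: "summable ?f" by (rule summable_spin_moment) (use assms in auto)
  have "(?f has_sum spin_moment ?M p z) UNIV"
    unfolding spin_moment_def
    by (rule norm_summable_imp_has_sum) (use s assms in \<open>auto simp: abs_mult sums_iff\<close>)
  \<comment> \<open>Spins start at 1/2, so index 0 is removed; its term is zero.\<close>
  then have "(?f has_sum spin_moment ?M p z) {1..}"
    by (subst has_sum_cong_neutral[where T = UNIV and g = ?f]) (auto simp: not_le)
  then have "((\<lambda>k. ?f k / 2 ^ p) has_sum spin_moment ?M p z / 2 ^ p) {1..}"
    by (rule has_sum_divide_const)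
  also have "?this \<longleftrightarrow> (((\<lambda>j. j ^ p * z powr (2 * j) * degen n v j) \<circ> (\<lambda>k. real k / 2)) has_sum spin_moment ?M p z / 2 ^ p) {1..}"
    by (rule has_sum_cong)
      (use assms in \<open>auto simp: degen_def spin_coeff_def powr_realpow power_divide mult_ac add_ac\<close>)
  also have "\<dots> \<longleftrightarrow> ((\<lambda>j. j ^ p * z powr (2 * j) * degen n v j) has_sum spin_moment ?M p z / 2 ^ p) ((\<lambda>k. real k / 2) ` {1..})"
    by (rule has_sum_reindex[symmetric]) (auto simp: inj_on_def)
  also have "(\<lambda>k. real k / 2) ` {1..} = spins"
    by (auto simp: spins_def)
  finally show ?thesis by (rule infsumI)
qed

text \<open>The two definite descriptions have equivalent predicates: for each \<open>z\<close>
  strictly between 0 and 1 the quotient of spin sums is the mean spin.\<close>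

lemma z0_eq_fugacity: "z0 n v x y = fugacity (2 * n * (v + 1) + 1) (x / y)"
  unfolding z0_def fugacity_def
proof (rule arg_cong[where f = The], rule ext, rule conj_cong[OF refl], rule conj_cong[OF refl])
  fix z :: real assume "0 < z" "z < 1"
  then show "((\<Sum>\<^sub>\<infinity>j\<in>spins. j * z powr (2 * j) * degen n v j) / (\<Sum>\<^sub>\<infinity>j\<in>spins. z powr (2 * j) * degen n v j) = x / y)
     = (mean_spin (2 * n * (v + 1) + 1) z = x / y)"
    using infsum_spins[of z 1 n v] infsum_spins[of z 0 n v]
    by (simp only: mean_spin_def power_one_right power_0 mult_1 div_by_1)
qed

text \<open>As \<open>- beta * j\<close> equals \<open>2 * j * ln z0\<close> and \<open>z0\<close>
  is positive, the Boltzmann factor is \<open>z0 powr (2 * j)\<close>, and the sum is the zeroth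
  moment.\<close>

lemma mu_eq:
  assumes "1 / 2 < x / y"
  shows "mu n v x y = ln (spin_moment (2 * n * (v + 1) + 1) 0 (z0 n v x y))"
proof -
  have z: "0 < z0 n v x y" "z0 n v x y < 1"
    unfolding z0_eq_fugacity using fugacity[OF assms] by auto
  have "exp (- beta n v x y * j) = z0 n v x y powr (2 * j)" for j
    using z by (simp add: beta_def powr_def mult_ac)
  then show ?thesis
    unfolding mu_def using infsum_spins[OF z, of 0 n v] by simp
qed

section \<open>The differential of the contribution of one triangle\<close>

lemma has_derivative_beta_mu:
  assumes "0 < y" "y / 2 < x"
  shows "((\<lambda>(x, y). beta n v x y * x + mu n v x y * y) has_derivative
           (\<lambda>(dx, dy). beta n v x y * dx + mu n v x y * dy)) (at (x, y))"
proof -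
  define M where "M = 2 * n * (v + 1) + 1"
  define \<psi> where "\<psi> r = - 2 * r * ln (fugacity M r) + ln (spin_moment M 0 (fugacity M r))" for r
  \<comment> \<open>An open set around \<open>(x, y)\<close> on which the identity \<open>eq\<close>
    holds, so that the derivative can be computed on the homogeneous form.\<close>
  define S where "S = {p :: real \<times> real. 0 < snd p \<and> snd p / 2 < fst p}"
  have r: "1 / 2 < fst p / snd p" if "p \<in> S" for p
    using that by (auto simp: S_def field_simps)
  \<comment> \<open>The factor \<open>y\<close> cancels the denominator of \<open>r = x / y\<close>:
    the first term of \<open>\<psi>\<close> becomes \<open>beta * x\<close> and, by
    \<open>mu_eq\<close>, the second becomes \<open>mu * y\<close>.\<close>
  have eq: "snd p * \<psi> (fst p / snd p) = (case p of (x, y) \<Rightarrow> beta n v x y * x + mu n v x y * y)"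
    if "p \<in> S" for p
    using mu_eq[OF r[OF that], of n v] that
    by (auto simp: \<psi>_def beta_def z0_eq_fugacity M_def S_def algebra_simps split: prod.splits)
  have xy: "(x, y) \<in> S" using assms by (simp add: S_def)
  have "open S"
    unfolding S_def by (intro open_Collect_conj open_Collect_less continuous_intros) simp
  have \<psi>': "(\<psi> has_real_derivative beta n v x y) (at (fst (x, y) / snd (x, y)))"
    unfolding \<psi>_def beta_def z0_eq_fugacity M_def[symmetric]
    using DERIV_legendre[OF r[OF xy], of M] by simp
  have q: "((\<lambda>p. fst p / snd p) has_derivative (\<lambda>d. fst d / y - x * snd d / y\<^sup>2)) (at (x, y))"
    using assms by (auto intro!: derivative_eq_intros simp: field_simps power2_eq_square)
  have "((\<lambda>p. \<psi> (fst p / snd p)) has_derivative (\<lambda>d. beta n v x y * (fst d / y - x * snd d / y\<^sup>2))) (at (x, y))"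
    using has_derivative_compose[OF q \<psi>'[unfolded has_field_derivative_def]] .
  then have "((\<lambda>p. snd p * \<psi> (fst p / snd p)) has_derivative
      (\<lambda>d. y * (beta n v x y * (fst d / y - x * snd d / y\<^sup>2)) + snd d * \<psi> (x / y))) (at (x, y))"
    by (auto intro!: derivative_eq_intros)
  \<comment> \<open>The coefficient of \<open>snd d\<close> is
    \<open>\<psi> (x / y) - x / y * beta\<close>, which is \<open>mu\<close> by \<open>eq\<close> at
    \<open>(x, y)\<close>.\<close>
  moreover have "(\<lambda>d. y * (beta n v x y * (fst d / y - x * snd d / y\<^sup>2)) + snd d * \<psi> (x / y))
      = (\<lambda>(dx, dy). beta n v x y * dx + mu n v x y * dy)"
    using eq[OF xy] assms by (auto simp: fun_eq_iff field_simps power2_eq_square)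
  ultimately show ?thesis
    using has_derivative_transform_within_open[OF _ \<open>open S\<close> xy eq] by simp
qed

section \<open>The entropy of the whole surface, and its reduction for equal triangle data\<close>

text \<open>Regrouped, each summand is a fixed linear combination of the one-triangle contributions
  of index \<open>n\<close> and index 1, so linearity of the derivative suffices.\<close>

lemma has_derivative_renyi_entropy:
  fixes nv :: "'t::finite \<Rightarrow> nat" and J N :: "real^'t"
  assumes N: "\<And>\<Delta>. 0 < N $ \<Delta>" and J: "\<And>\<Delta>. N $ \<Delta> / 2 < J $ \<Delta>"
  shows "(renyi_entropy nv n has_derivative
            (\<lambda>(dJ, dN). \<Sum>\<Delta>\<in>UNIV.
               renyi_lambda n (nv \<Delta>) (J $ \<Delta>) (N $ \<Delta>) * dJ $ \<Delta>
             + renyi_sigma n (nv \<Delta>) (J $ \<Delta>) (N $ \<Delta>) * dN $ \<Delta>)) (at (J, N))"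
proof -
  define h where "h n \<Delta> = (\<lambda>(x, y). beta n (nv \<Delta>) x y * x + mu n (nv \<Delta>) x y * y)" for n \<Delta>
  define h' where "h' n \<Delta> = (\<lambda>(dx, dy). beta n (nv \<Delta>) (J $ \<Delta>) (N $ \<Delta>) * dx
      + mu n (nv \<Delta>) (J $ \<Delta>) (N $ \<Delta>) * dy)" for n \<Delta>
  have pr: "((\<lambda>p. (fst p $ \<Delta>, snd p $ \<Delta>)) has_derivative (\<lambda>p. (fst p $ \<Delta>, snd p $ \<Delta>))) (at (J, N))" for \<Delta>
    by (intro bounded_linear_imp_has_derivative bounded_linear_Pair
        bounded_linear_compose[OF bounded_linear_vec_nth] bounded_linear_fst bounded_linear_snd)
  have "((\<lambda>p. h n \<Delta> (fst p $ \<Delta>, snd p $ \<Delta>)) has_derivative (\<lambda>p. h' n \<Delta> (fst p $ \<Delta>, snd p $ \<Delta>))) (at (J, N))" for n \<Delta>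
    using has_derivative_compose[OF pr, of "h n \<Delta>" "h' n \<Delta>" \<Delta>] has_derivative_beta_mu[OF N J, of n "nv \<Delta>" \<Delta>]
    by (simp only: h_def h'_def fst_conv snd_conv)
  then have "((\<lambda>p. (h n \<Delta> (fst p $ \<Delta>, snd p $ \<Delta>) - real n * h 1 \<Delta> (fst p $ \<Delta>, snd p $ \<Delta>)) / (1 - real n))
     has_derivative (\<lambda>p. (h' n \<Delta> (fst p $ \<Delta>, snd p $ \<Delta>) - real n * h' 1 \<Delta> (fst p $ \<Delta>, snd p $ \<Delta>)) / (1 - real n))) (at (J, N))" for \<Delta>
    unfolding divide_inverse by (intro has_derivative_mult_left has_derivative_diff has_derivative_mult_right)
  then have "((\<lambda>p. \<Sum>\<Delta>\<in>UNIV. (h n \<Delta> (fst p $ \<Delta>, snd p $ \<Delta>) - real n * h 1 \<Delta> (fst p $ \<Delta>, snd p $ \<Delta>)) / (1 - real n))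
     has_derivative (\<lambda>p. \<Sum>\<Delta>\<in>UNIV. (h' n \<Delta> (fst p $ \<Delta>, snd p $ \<Delta>) - real n * h' 1 \<Delta> (fst p $ \<Delta>, snd p $ \<Delta>)) / (1 - real n))) (at (J, N))"
    by (rule has_derivative_sum)
  \<comment> \<open>Used twice: on the summands of the entropy and on those of its
    differential.\<close>
  moreover have combine: "(b * x + m * y - c * (b1 * x + m1 * y)) / d = (b - c * b1) / d * x + (m - c * m1) / d * y"
    for b x m y c b1 m1 d :: real
    by (simp add: algebra_simps flip: add_divide_distrib)
  ultimately show ?thesis
    unfolding renyi_entropy_def renyi_lambda_def renyi_sigma_def h_def h'_def case_prod_unfold
    by (simp only: combine fst_conv snd_conv)
qed

theorem theorem8p1:
  fixes nv :: "'t::finite \<Rightarrow> nat" and n :: nat and J N :: "real^'t"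
  assumes "2 \<le> n"
    and "\<And>\<Delta>. 1 \<le> nv \<Delta>"
    and "\<And>\<Delta>. 0 < N $ \<Delta>"
    and "\<And>\<Delta>. N $ \<Delta> / 2 < J $ \<Delta>"
  shows "(renyi_entropy nv n has_derivative
            (\<lambda>(dJ, dN). \<Sum>\<Delta>\<in>UNIV.
               renyi_lambda n (nv \<Delta>) (J $ \<Delta>) (N $ \<Delta>) * dJ $ \<Delta>
             + renyi_sigma n (nv \<Delta>) (J $ \<Delta>) (N $ \<Delta>) * dN $ \<Delta>)) (at (J, N))
    \<and> ((\<forall>\<Delta> \<Delta>'. nv \<Delta> = nv \<Delta>') \<longrightarrow>
         (\<forall>\<Delta> \<Delta>'. beta n (nv \<Delta>) = beta n (nv \<Delta>') \<and> beta 1 (nv \<Delta>) = beta 1 (nv \<Delta>')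
            \<and> mu n (nv \<Delta>) = mu n (nv \<Delta>') \<and> mu 1 (nv \<Delta>) = mu 1 (nv \<Delta>')
            \<and> renyi_lambda n (nv \<Delta>) = renyi_lambda n (nv \<Delta>')
            \<and> renyi_sigma n (nv \<Delta>) = renyi_sigma n (nv \<Delta>'))
       \<and> ((\<forall>\<Delta> \<Delta>'. J $ \<Delta> / N $ \<Delta> = J $ \<Delta>' / N $ \<Delta>') \<longrightarrow>
            (\<exists>b b1 m m1 l s.
               (\<forall>\<Delta>. beta n (nv \<Delta>) (J $ \<Delta>) (N $ \<Delta>) = b
                  \<and> beta 1 (nv \<Delta>) (J $ \<Delta>) (N $ \<Delta>) = b1
                  \<and> mu n (nv \<Delta>) (J $ \<Delta>) (N $ \<Delta>) = m
                  \<and> mu 1 (nv \<Delta>) (J $ \<Delta>) (N $ \<Delta>) = m1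
                  \<and> renyi_lambda n (nv \<Delta>) (J $ \<Delta>) (N $ \<Delta>) = l
                  \<and> renyi_sigma n (nv \<Delta>) (J $ \<Delta>) (N $ \<Delta>) = s)
             \<and> (renyi_entropy nv n has_derivative
                  (\<lambda>(dJ, dN). l * total_over dJ + s * total_over dN)) (at (J, N)))))"
proof (intro conjI impI)
  note D = has_derivative_renyi_entropy[OF assms(3,4), of nv n]
  show "(renyi_entropy nv n has_derivative
            (\<lambda>(dJ, dN). \<Sum>\<Delta>\<in>UNIV.
               renyi_lambda n (nv \<Delta>) (J $ \<Delta>) (N $ \<Delta>) * dJ $ \<Delta>
             + renyi_sigma n (nv \<Delta>) (J $ \<Delta>) (N $ \<Delta>) * dN $ \<Delta>)) (at (J, N))"
    by (rule D)
  assume nv: "\<forall>\<Delta> \<Delta>'. nv \<Delta> = nv \<Delta>'"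
  show "\<forall>\<Delta> \<Delta>'. beta n (nv \<Delta>) = beta n (nv \<Delta>') \<and> beta 1 (nv \<Delta>) = beta 1 (nv \<Delta>')
            \<and> mu n (nv \<Delta>) = mu n (nv \<Delta>') \<and> mu 1 (nv \<Delta>) = mu 1 (nv \<Delta>')
            \<and> renyi_lambda n (nv \<Delta>) = renyi_lambda n (nv \<Delta>')
            \<and> renyi_sigma n (nv \<Delta>) = renyi_sigma n (nv \<Delta>')"
    using nv by metis
  assume r: "\<forall>\<Delta> \<Delta>'. J $ \<Delta> / N $ \<Delta> = J $ \<Delta>' / N $ \<Delta>'"
  \<comment> \<open>Equal \<open>nv\<close> makes the functions coincide. Their values coincide
    because \<open>z0\<close>, hence \<open>beta\<close> and \<open>mu\<close>, depends on the
    variables only through the common ratio \<open>\<rho>\<close>.\<close>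
  obtain \<nu> \<rho> where \<nu>: "nv \<Delta> = \<nu>" and \<rho>: "J $ \<Delta> / N $ \<Delta> = \<rho>" for \<Delta>
    using nv r by metis
  define B where "B m = - 2 * ln (fugacity (2 * m * (\<nu> + 1) + 1) \<rho>)" for m
  define U where "U m = ln (\<Sum>\<^sub>\<infinity>j\<in>spins. exp (- B m * j) * degen m \<nu> j)" for m
  have b: "beta m (nv \<Delta>) (J $ \<Delta>) (N $ \<Delta>) = B m" for m \<Delta>
    unfolding beta_def z0_eq_fugacity \<nu> \<rho> B_def ..
  have u: "mu m (nv \<Delta>) (J $ \<Delta>) (N $ \<Delta>) = U m" for m \<Delta>
    unfolding mu_def b U_def unfolding \<nu> ..
  have l: "renyi_lambda n (nv \<Delta>) (J $ \<Delta>) (N $ \<Delta>) = (B n - real n * B 1) / (1 - real n)" for \<Delta>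
    unfolding renyi_lambda_def b ..
  have s: "renyi_sigma n (nv \<Delta>) (J $ \<Delta>) (N $ \<Delta>) = (U n - real n * U 1) / (1 - real n)" for \<Delta>
    unfolding renyi_sigma_def u ..
  have "(renyi_entropy nv n has_derivative
      (\<lambda>(dJ, dN). (B n - real n * B 1) / (1 - real n) * total_over dJ
        + (U n - real n * U 1) / (1 - real n) * total_over dN)) (at (J, N))"
    using D unfolding l s total_over_def sum.distrib sum_distrib_left .
  with b u l s show "\<exists>b b1 m m1 l s.
               (\<forall>\<Delta>. beta n (nv \<Delta>) (J $ \<Delta>) (N $ \<Delta>) = b
                  \<and> beta 1 (nv \<Delta>) (J $ \<Delta>) (N $ \<Delta>) = b1
                  \<and> mu n (nv \<Delta>) (J $ \<Delta>) (N $ \<Delta>) = m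
                  \<and> mu 1 (nv \<Delta>) (J $ \<Delta>) (N $ \<Delta>) = m1
                  \<and> renyi_lambda n (nv \<Delta>) (J $ \<Delta>) (N $ \<Delta>) = l
                  \<and> renyi_sigma n (nv \<Delta>) (J $ \<Delta>) (N $ \<Delta>) = s)
             \<and> (renyi_entropy nv n has_derivative
                  (\<lambda>(dJ, dN). l * total_over dJ + s * total_over dN)) (at (J, N))"
    by blast
qed

end
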